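(* Let $N$ and $\ell_1,\ldots,\ell_{d+1}$ be positive integers with $\ell_i\le N$ for all $i$ and $\ell_i+\ell_j\ge N$ for $i\ne j$. For $\nu\in\mathbb N_0^d$ define $$G_\nu(x)=G_\nu^{\ell}(x)=\prod_{j=1}^d(1-|\mathbf x_{j-1}|)^{\nu_j}\,G_{\nu_j}^{(\mathsf a_j,\ell_j)}\left(\frac{2x_j}{1-|\mathbf x_{j-1}|}-1\right),\qquad x\in\mathbb R^d.$$ Then, for every $\nu\in H_{\ell,N}^d$, the polynomials $\mathsf H_\nu(\cdot;\ell,N)$ satisfy $$|y|^N\,G_\nu\left(\frac{y'}{|y|}\right)=\sum_{\alpha\in\mathbb N_0^{d+1},\ |\alpha|=N}\frac{N!}{\alpha!}\,\mathsf H_\nu(\alpha;\ell,N)\,y^\alpha,$$ where $y=(y',y_{d+1})\in\mathbb R^{d+1}$, $|y|=y_1+\cdots+y_{d+1}$, $\alpha!=\alpha_1!\cdots\alpha_{d+1}!$ and $y^\alpha=y_1^{\alpha_1}\cdots y_{d+1}^{\alpha_{d+1}}$.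
   Context: Notation: $(a)_k$ is the Pochhammer symbol; $|\cdot|$ of a vector is the sum of its entries; $|\mathbf x_{j-1}|=x_1+\cdots+x_{j-1}$, $|\mathbf x_0|=0$; $|\boldsymbol\nu^{j+1}|=\nu_{j+1}+\cdots+\nu_d$, $|\boldsymbol\nu^{d+1}|=0$; $|\boldsymbol\ell^{j+1}|=\ell_{j+1}+\cdots+\ell_{d+1}$; $\mathsf a_j=|\boldsymbol\ell^{j+1}|-2|\boldsymbol\nu^{j+1}|$. For integers $a,b$ and $0\le n\le a\wedge b$ (minimum), $G_n^{(a,b)}(t)={}_2F_1\left(\begin{matrix}-n,\ n-a-b-1\\-a\end{matrix};\frac{1-t}2\right)$. Index set: $H_{\ell,N}^d=\{\nu\in\mathbb N_0^d:\ |\nu|\le N,\ |\nu|\le|\ell|-N,\ \nu_j\le\ell_j,\ \nu_j\le\mathsf a_j,\ 1\le j\le d\}$. Hahn polynomials: with $\mathsf Q_n(t;a,b,M)=\sum_{k=0}^n\frac{(-n)_k(n-a-b-1)_k(-t)_k}{(-a)_k(-M)_kk!}$ and $N_j=N-|\mathbf x_{j-1}|-|\boldsymbol\nu^{j+1}|$, $$\mathsf Q_\nu(x;\ell,N)=\prod_{j=1}^d(-N_j)_{\nu_j}\,\mathsf Q_{\nu_j}(x_j;\ell_j,\mathsf a_j,N_j),$$ a polynomial in $x\in\mathbb R^d$ (using $(-N_j)_{\nu_j}/(-N_j)_k=(-N_j+k)_{\nu_j-k}$). The renormalized polynomials, in homogeneous coordinates $\alpha=(\alpha',\alpha_{d+1})\in\mathbb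 N_0^{d+1}$ with $\alpha'=(\alpha_1,\ldots,\alpha_d)$ and $|\alpha|=N$, are $$\mathsf H_\nu(\alpha;\ell,N)=\frac{(-1)^{|\nu|}}{(-N)_{|\nu|}}\prod_{j=1}^d\frac{(-\ell_j)_{\nu_j}}{(-\mathsf a_j)_{\nu_j}}\ \mathsf Q_\nu(\alpha';\ell,N).$$ The left-hand side of the identity is understood as the homogeneous polynomial in $y$ that it defines. *)

theory Defs
  imports Complex_Main
begin

text \<open>
  Vectors and multi-indices of length \<open>m\<close> are functions on \<^typ>\<open>nat\<close> of which only the
  values at \<open>1, \<dots>, m\<close> are relevant.  Whenever a set of multi-indices is formed, they are
  normalised to be zero elsewhere, so that each tuple is represented exactly once.
\<close>

definition multi_indices :: "nat \<Rightarrow> (nat \<Rightarrow> nat) set" where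
  "multi_indices m = {\<alpha>. \<forall>i. i \<notin> {1..m} \<longrightarrow> \<alpha> i = 0}"

definition head_sum :: "(nat \<Rightarrow> 'a::comm_monoid_add) \<Rightarrow> nat \<Rightarrow> 'a" where
  "head_sum x k = (\<Sum>i=1..k. x i)"

definition multi_indices_of_sum :: "nat \<Rightarrow> nat \<Rightarrow> (nat \<Rightarrow> nat) set" where
  "multi_indices_of_sum m N = {\<alpha> \<in> multi_indices m. head_sum \<alpha> m = N}"

text \<open>
  \<open>tail_sum x k m\<close> is \<open>x\<^sub>k + \<dots> + x\<^sub>m\<close>, and \<open>0\<close> if \<open>k > m\<close>.  The number \<open>a\<^sub>j\<close> can be negative,
  hence it is an integer.
\<close>

definition tail_sum :: "(nat \<Rightarrow> nat) \<Rightarrow> nat \<Rightarrow> nat \<Rightarrow> nat" where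
  "tail_sum x k m = (\<Sum>i=k..m. x i)"

definition a_par :: "nat \<Rightarrow> (nat \<Rightarrow> nat) \<Rightarrow> (nat \<Rightarrow> nat) \<Rightarrow> nat \<Rightarrow> int" where
  "a_par d l \<nu> j = int (tail_sum l (j + 1) (d + 1)) - 2 * int (tail_sum \<nu> (j + 1) d)"

definition H_set :: "nat \<Rightarrow> (nat \<Rightarrow> nat) \<Rightarrow> nat \<Rightarrow> (nat \<Rightarrow> nat) set" where
  "H_set d l N = {\<nu> \<in> multi_indices d.
     head_sum \<nu> d \<le> N \<and>
     int (head_sum \<nu> d) \<le> int (head_sum l (d + 1)) - int N \<and>
     (\<forall>j\<in>{1..d}. \<nu> j \<le> l j \<and> int (\<nu> j) \<le> a_par d l \<nu> j)}"

text \<open>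
  The Gauss hypergeometric series.  For an upper parameter \<open>-n\<close> and a lower parameter \<open>-a\<close>
  with \<open>n \<le> a\<close> all terms with \<open>k > n\<close> vanish (also for \<open>k > a\<close>, where both the numerator and
  the denominator are zero), so the series is the usual terminating sum over \<open>k \<le> n\<close>.
\<close>

definition hyp2F1 :: "real \<Rightarrow> real \<Rightarrow> real \<Rightarrow> real \<Rightarrow> real" where
  "hyp2F1 a b c z =
     (\<Sum>k. pochhammer a k * pochhammer b k / (pochhammer c k * fact k) * z ^ k)"

definition G_uni :: "nat \<Rightarrow> int \<Rightarrow> int \<Rightarrow> real \<Rightarrow> real" where
  "G_uni n a b t =
     hyp2F1 (- real n) (real n - of_int a - of_int b - 1) (- of_int a) ((1 - t) / 2)"

text \<open>
  Because of the division, this expression is meaningful only at points \<open>x\<close> with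
  \<open>x\<^sub>1 + \<dots> + x\<^bsub>j-1\<^esub> \<noteq> 1\<close> for all \<open>j \<le> d\<close>.
\<close>

definition G_poly :: "nat \<Rightarrow> (nat \<Rightarrow> nat) \<Rightarrow> (nat \<Rightarrow> nat) \<Rightarrow> (nat \<Rightarrow> real) \<Rightarrow> real" where
  "G_poly d l \<nu> x =
     (\<Prod>j=1..d. (1 - head_sum x (j - 1)) ^ \<nu> j *
        G_uni (\<nu> j) (a_par d l \<nu> j) (int (l j)) (2 * x j / (1 - head_sum x (j - 1)) - 1))"

definition hahn_Q :: "nat \<Rightarrow> real \<Rightarrow> real \<Rightarrow> real \<Rightarrow> real \<Rightarrow> real" where
  "hahn_Q n t a b M =
     (\<Sum>k=0..n. pochhammer (- real n) k * pochhammer (real n - a - b - 1) k * pochhammer (- t) k /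
        (pochhammer (- a) k * pochhammer (- M) k * fact k))"

text \<open>
  The polynomial \<open>(-M)\<^sub>n Q\<^sub>n(t; a, b, M)\<close> in \<open>t\<close> and \<open>M\<close>, in which the quotient
  \<open>(-M)\<^sub>n / (-M)\<^sub>k\<close> is cancelled to \<open>(-M + k)\<^bsub>n-k\<^esub>\<close>.
\<close>

definition hahn_Q_scaled :: "nat \<Rightarrow> real \<Rightarrow> real \<Rightarrow> real \<Rightarrow> real \<Rightarrow> real" where
  "hahn_Q_scaled n t a b M =
     (\<Sum>k=0..n. pochhammer (- real n) k * pochhammer (real n - a - b - 1) k * pochhammer (- t) k /
        (pochhammer (- a) k * fact k) * pochhammer (- M + real k) (n - k))"

lemma hahn_Q_scaled_eq:
  assumes "pochhammer (- M) n \<noteq> 0"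
  shows "hahn_Q_scaled n t a b M = pochhammer (- M) n * hahn_Q n t a b M"
  unfolding hahn_Q_scaled_def hahn_Q_def sum_distrib_left
proof (rule sum.cong)
  fix k assume "k \<in> {0..n}"
  then have split: "pochhammer (- M) n = pochhammer (- M) k * pochhammer (- M + real k) (n - k)"
    by (simp add: pochhammer_product)
  with assms have "pochhammer (- M) k \<noteq> 0" by auto
  then show "pochhammer (- real n) k * pochhammer (real n - a - b - 1) k * pochhammer (- t) k /
        (pochhammer (- a) k * fact k) * pochhammer (- M + real k) (n - k) =
      pochhammer (- M) n * (pochhammer (- real n) k * pochhammer (real n - a - b - 1) k *
        pochhammer (- t) k / (pochhammer (- a) k * pochhammer (- M) k * fact k))"
    unfolding split by simp
qed simp

definition hahn_Q_multi ::
  "nat \<Rightarrow> (nat \<Rightarrow> nat) \<Rightarrow> (nat \<Rightarrow> nat) \<Rightarrow> nat \<Rightarrow> (nat \<Rightarrow> real) \<Rightarrow> real" where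
  "hahn_Q_multi d \<nu> l N x =
     (\<Prod>j=1..d. hahn_Q_scaled (\<nu> j) (x j) (real (l j)) (of_int (a_par d l \<nu> j))
        (real N - head_sum x (j - 1) - real (tail_sum \<nu> (j + 1) d)))"

definition hahn_H ::
  "nat \<Rightarrow> (nat \<Rightarrow> nat) \<Rightarrow> (nat \<Rightarrow> nat) \<Rightarrow> nat \<Rightarrow> (nat \<Rightarrow> nat) \<Rightarrow> real" where
  "hahn_H d \<nu> l N \<alpha> =
     (-1) ^ head_sum \<nu> d / pochhammer (- real N) (head_sum \<nu> d) *
     (\<Prod>j=1..d. pochhammer (- real (l j)) (\<nu> j) / pochhammer (- of_int (a_par d l \<nu> j)) (\<nu> j)) *
     hahn_Q_multi d \<nu> l N (\<lambda>i. real (\<alpha> i))"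

definition multi_fact :: "nat \<Rightarrow> (nat \<Rightarrow> nat) \<Rightarrow> real" where
  "multi_fact m \<alpha> = (\<Prod>i=1..m. fact (\<alpha> i))"

definition monomial_at :: "nat \<Rightarrow> (nat \<Rightarrow> real) \<Rightarrow> (nat \<Rightarrow> nat) \<Rightarrow> real" where
  "monomial_at m y \<alpha> = (\<Prod>i=1..m. y i ^ \<alpha> i)"

text \<open>
  The points at which no denominator occurring in \<open>G\<^sub>\<nu>(y'/|y|)\<close> vanishes:
  with \<open>x = y'/|y|\<close>, one has \<open>1 - |x\<^bsub>j-1\<^esub>| = (|y| - |y\<^bsub>j-1\<^esub>|) / |y|\<close>.
\<close>

definition admissible :: "nat \<Rightarrow> (nat \<Rightarrow> real) \<Rightarrow> bool" where
  "admissible d y \<longleftrightarrow> head_sum y (d + 1) \<noteq> 0 \<and>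
     (\<forall>j\<in>{1..d}. 1 - head_sum (\<lambda>i. y i / head_sum y (d + 1)) (j - 1) \<noteq> 0)"

end

(* Let R_j = y_j + ... + y_{d+1}.  Reflecting each Gauss series from 1 - y_j/R_j to y_j/R_j (by
   Chu-Vandermonde) produces the prefactors of H_nu and turns both sides into products over j of sums
   over k_j with the same coefficients.  The identity then follows by summing out the variables one at
   a time from the left: expanding the power of R_j in powers of y_j and R_{j+1} by the binomial
   theorem gives one Hahn factor at a time.  For the uniqueness of the coefficients only the points
   with positive coordinates are needed, all of which are admissible. *)

theory Submission
  imports Defs "HOL-Computational_Algebra.Formal_Power_Series"
begin

section \<open>Pochhammer symbols and the reflection of a terminating Gauss series\<close>

lemma pochhammer_minus_nat:
  "pochhammer (- real L) p = (if p \<le> L then (-1) ^ p * fact L / fact (L - p) else 0)"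
proof (induction p)
  case (Suc p)
  show ?case
  proof (cases "Suc p \<le> L")
    case True
    then have "fact (L - p) = real (L - p) * fact (L - Suc p)"
      by (subst fact_reduce) auto
    with True Suc show ?thesis
      by (simp add: pochhammer_rec' of_nat_diff field_simps)
  next
    case False
    with Suc show ?thesis
      by (cases "p = L") (auto simp: pochhammer_rec')
  qed
qed simp

lemma pochhammer_minus_nonzero:
  assumes "real n \<le> a"
  shows "pochhammer (- a) n \<noteq> 0"
  using assms by (auto simp: pochhammer_eq_0_iff)

lemma pochhammer_nonzero_le:
  assumes "pochhammer (c::real) n \<noteq> 0" "k \<le> n"
  shows "pochhammer c k \<noteq> 0"
  using assms pochhammer_product[of k n c] by auto

lemma chu_vandermonde:
  fixes b c :: real
  assumes "pochhammer c p \<noteq> 0"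
  shows "(\<Sum>i=0..p. pochhammer (- real p) i * pochhammer b i / (pochhammer c i * fact i)) =
    pochhammer (c - b) p / pochhammer c p"
proof -
  have "\<forall>i\<in>{0..<p}. c \<noteq> - of_nat i"
    using assms by (auto simp: pochhammer_eq_0_iff)
  from Vandermonde_pochhammer[OF this, of b] show ?thesis
    by (simp add: mult.commute)
qed

text \<open>Expanding each (1 - u)^k, the coefficient of u^m is a multiple of a terminating Gauss
  series at 1 with all parameters raised by m, which Chu-Vandermonde evaluates. The new lower
  parameter is the usual A + B + 1 - c of the connection between the singular points 0 and 1, with A
  = -n.\<close>

lemma hypergeometric_reflection:
  fixes B c u :: real
  assumes c: "pochhammer c n \<noteq> 0" and c': "pochhammer (1 + B - real n - c) n \<noteq> 0"
  shows "(\<Sum>k=0..n. pochhammer (- real n) k * pochhammer B k / (pochhammer c k * fact k) * (1 - u) ^ k)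
    = (-1) ^ n * pochhammer (1 + B - real n - c) n / pochhammer c n *
      (\<Sum>k=0..n. pochhammer (- real n) k * pochhammer B k /
         (pochhammer (1 + B - real n - c) k * fact k) * u ^ k)"
proof -
  define c' where "c' = 1 + B - real n - c"
  define t where "t k = pochhammer (- real n) k * pochhammer B k / (pochhammer c k * fact k)" for k
  have coeff: "(\<Sum>k=m..n. t k * real (k choose m)) * (-1) ^ m =
      (-1) ^ n * pochhammer c' n / pochhammer c n *
      (pochhammer (- real n) m * pochhammer B m / (pochhammer c' m * fact m))" if m: "m \<le> n" for m
  proof -
    have cm: "pochhammer c n = pochhammer c m * pochhammer (c + m) (n - m)"
      using m by (rule pochhammer_product)
    have nz: "pochhammer (c + m) (n - m) \<noteq> 0" "pochhammer c m \<noteq> 0"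
      using c unfolding cm by auto
    have c'm: "pochhammer c' m \<noteq> 0"
      using c' m pochhammer_nonzero_le unfolding c'_def by blast
    have "(\<Sum>k=m..n. t k * real (k choose m)) = (\<Sum>i=0..n-m. t (i + m) * real ((i + m) choose m))"
      using m sum.shift_bounds_cl_nat_ivl[of "\<lambda>k. t k * real (k choose m)" 0 m "n - m"] by simp
    \<comment> \<open>Each Pochhammer symbol of length i + m splits into one of length m and one of
      length i with shifted base; the first ones leave the sum.\<close>
    also have "\<dots> = (\<Sum>i=0..n-m. pochhammer (- real n) m * pochhammer B m / (pochhammer c m * fact m) *
        (pochhammer (- real (n - m)) i * pochhammer (B + m) i / (pochhammer (c + m) i * fact i)))"
    proof (rule sum.cong[OF refl])
      fix i assume "i \<in> {0..n-m}"
      have ch: "real ((i + m) choose m) = fact (i + m) / (fact m * fact i)"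
        by (simp add: binomial_fact)
      have poch: "pochhammer x (i + m) = pochhammer x m * pochhammer (x + m) i" for x :: real
        using pochhammer_product'[of x m i] by (simp add: add.commute)
      have mn: "- real n + real m = - real (n - m)"
        using m by (simp add: of_nat_diff)
      show "t (i + m) * real ((i + m) choose m) =
          pochhammer (- real n) m * pochhammer B m / (pochhammer c m * fact m) *
        (pochhammer (- real (n - m)) i * pochhammer (B + m) i / (pochhammer (c + m) i * fact i))"
        unfolding t_def ch poch mn by (simp add: mult_ac)
    qed
    also have "\<dots> = pochhammer (- real n) m * pochhammer B m / (pochhammer c m * fact m) *
        (pochhammer (c - B) (n - m) / pochhammer (c + m) (n - m))"
      unfolding sum_distrib_left[symmetric] chu_vandermonde[OF nz(1)] by simp
    finally have *: "(\<Sum>k=m..n. t k * real (k choose m)) =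
        pochhammer (- real n) m * pochhammer B m * pochhammer (c - B) (n - m) / (pochhammer c n * fact m)"
      by (simp add: cm)
    have "pochhammer c' n = pochhammer c' m * pochhammer (c' + m) (n - m)"
      using m by (rule pochhammer_product)
    \<comment> \<open>Reading the product backwards: the base becomes B - c - (n - m) + 1, which is
      exactly \<open>c' + m\<close>, so the product completes \<open>pochhammer c' m\<close> to
      \<open>pochhammer c' n\<close>.\<close>
    moreover have "pochhammer (c - B) (n - m) = (-1) ^ (n - m) * pochhammer (c' + m) (n - m)"
      using pochhammer_minus[of "B - c" "n - m"] m by (simp add: c'_def of_nat_diff algebra_simps)
    moreover have "(-1::real) ^ n = (-1) ^ (n - m) * (-1) ^ m"
      using m by (simp flip: power_add)
    ultimately show ?thesis
      using c'm c by (simp add: * field_simps)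
  qed
  have "(\<Sum>k=0..n. t k * (1 - u) ^ k) = (\<Sum>k=0..n. \<Sum>m=0..k. t k * (k choose m) * (-1) ^ m * u ^ m)"
  proof (rule sum.cong[OF refl])
    fix k
    have "(1 - u) ^ k = (\<Sum>m\<le>k. (k choose m) * (- u) ^ m)"
      using binomial_ring[of "- u" 1 k] by simp
    also have "\<dots> = (\<Sum>m=0..k. (k choose m) * ((-1) ^ m * u ^ m))"
      by (simp add: atMost_atLeast0 flip: power_mult_distrib)
    finally show "t k * (1 - u) ^ k = (\<Sum>m=0..k. t k * (k choose m) * (-1) ^ m * u ^ m)"
      by (simp add: sum_distrib_left mult_ac)
  qed
  \<comment> \<open>The triangle m \<le> k is written as a restriction of a square so that the two
    sums can be exchanged.\<close>
  also have "\<dots> = (\<Sum>k=0..n. \<Sum>m | m \<in> {0..n} \<and> m \<le> k. t k * (k choose m) * (-1) ^ m * u ^ m)"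
    by (intro sum.cong) auto
  also have "\<dots> = (\<Sum>m=0..n. \<Sum>k | k \<in> {0..n} \<and> m \<le> k. t k * (k choose m) * (-1) ^ m * u ^ m)"
    by (rule sum.swap_restrict) auto
  also have "\<dots> = (\<Sum>m=0..n. (\<Sum>k=m..n. t k * (k choose m)) * (-1) ^ m * u ^ m)"
    unfolding sum_distrib_right by (intro sum.cong) auto
  also have "\<dots> = (\<Sum>m=0..n. (-1) ^ n * pochhammer c' n / pochhammer c n *
      (pochhammer (- real n) m * pochhammer B m / (pochhammer c' m * fact m)) * u ^ m)"
    by (intro sum.cong refl arg_cong[where f = "\<lambda>x. x * u ^ _"] coeff) simp
  finally show ?thesis
    by (simp add: t_def c'_def sum_distrib_left mult.assoc)
qed

text \<open>The factor of \<open>G\<^sub>\<nu>\<close> with index \<open>j\<close>, homogenised and expanded at the other singular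
  point: the argument is \<open>y / R\<close> instead of \<open>1 - y / R\<close>.\<close>

definition homog_G :: "nat \<Rightarrow> real \<Rightarrow> real \<Rightarrow> real \<Rightarrow> real \<Rightarrow> real" where
  "homog_G n a b y R =
     (\<Sum>k=0..n. pochhammer (- real n) k * pochhammer (real n - a - b - 1) k /
        (pochhammer (- a) k * fact k) * (y ^ k * R ^ (n - k)))"

text \<open>Reflection of the series with c = -a and B = n - a - b - 1 gives the lower parameter -b,
  so a and b change places. The bounds on n keep both denominators nonzero.\<close>

lemma G_uni_homog:
  assumes n: "int n \<le> a" "int n \<le> b" and R: "R \<noteq> 0"
  shows "R ^ n * G_uni n a b (2 * y / R - 1) =
    (-1) ^ n * pochhammer (- of_int b) n / pochhammer (- of_int a) n *
    homog_G n (of_int b) (of_int a) y R"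
proof -
  let ?B = "real n - of_int a - of_int b - 1"
  have arg: "(1 - (2 * y / R - 1)) / 2 = 1 - y / R"
    by (simp add: field_simps)
  have c': "1 + ?B - real n - (- of_int a) = - of_int b" by simp
  have nz: "pochhammer (- real_of_int a) n \<noteq> 0" "pochhammer (- real_of_int b) n \<noteq> 0"
    using n by (auto intro!: pochhammer_minus_nonzero)
  have "G_uni n a b (2 * y / R - 1) =
      (\<Sum>k=0..n. pochhammer (- real n) k * pochhammer ?B k /
         (pochhammer (- of_int a) k * fact k) * (1 - y / R) ^ k)"
    unfolding G_uni_def hyp2F1_def arg
    by (rule suminf_finite) (auto simp: pochhammer_minus_nat)
  also have "\<dots> = (-1) ^ n * pochhammer (- of_int b) n / pochhammer (- of_int a) n *
      (\<Sum>k=0..n. pochhammer (- real n) k * pochhammer ?B k /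
         (pochhammer (- of_int b) k * fact k) * (y / R) ^ k)"
    using hypergeometric_reflection[of "- of_int a" n ?B "y / R", unfolded c', OF nz] .
  finally have "R ^ n * G_uni n a b (2 * y / R - 1) =
     (-1) ^ n * pochhammer (- of_int b) n / pochhammer (- of_int a) n *
      (\<Sum>k=0..n. pochhammer (- real n) k * pochhammer ?B k /
         (pochhammer (- of_int b) k * fact k) * (R ^ n * (y / R) ^ k))"
    by (simp add: sum_distrib_left mult_ac)
  also have "(\<Sum>k=0..n. pochhammer (- real n) k * pochhammer ?B k /
         (pochhammer (- of_int b) k * fact k) * (R ^ n * (y / R) ^ k)) =
      homog_G n (of_int b) (of_int a) y R"
    unfolding homog_G_def
  proof (rule sum.cong[OF refl])
    fix k assume "k \<in> {0..n}"
    then have "R ^ n * (y / R) ^ k = y ^ k * R ^ (n - k)"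
      using R by (simp add: power_divide power_diff)
    \<comment> \<open>The second upper parameter is symmetric in a and b and survives their
      exchange.\<close>
    moreover have "?B = real n - of_int b - of_int a - 1" by simp
    ultimately show "pochhammer (- real n) k * pochhammer ?B k /
         (pochhammer (- of_int b) k * fact k) * (R ^ n * (y / R) ^ k) =
       pochhammer (- real n) k * pochhammer (real n - of_int b - of_int a - 1) k /
         (pochhammer (- of_int b) k * fact k) * (y ^ k * R ^ (n - k))"
      by (simp only:)
  qed
  finally show ?thesis .
qed

section \<open>Divided powers and the generating function in one variable\<close>

text \<open>The value \<open>0\<close> for \<open>M < m\<close> makes the one-variable summation below hold for every \<open>M\<close>; the
  induction needs these cases even if the total degree is large.\<close>

definition divided_power :: "nat \<Rightarrow> nat \<Rightarrow> real \<Rightarrow> real" where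
  "divided_power M m R = (if m \<le> M then R ^ (M - m) / fact (M - m) else 0)"

text \<open>The binomial theorem for divided powers: (-i)_k / i! is (-1)^k / (i - k)!, so after the
  shift i = q + k the sum is a convolution of y^q / q! with the divided powers of R.\<close>

lemma divided_power_convolution:
  "(\<Sum>i\<le>M. y ^ i / fact i * pochhammer (- real i) k * divided_power (M - i) m R) =
    (-1) ^ k * y ^ k * divided_power M (m + k) (y + R)"
proof (cases "m + k \<le> M")
  case True
  define L where "L = M - m - k"
  \<comment> \<open>Terms with i < k vanish by the Pochhammer factor, terms with i > M - m = L + k
    by the default value of \<open>divided_power\<close>.\<close>
  have "(\<Sum>i\<le>M. y ^ i / fact i * pochhammer (- real i) k * divided_power (M - i) m R) =
      (\<Sum>i=0+k..L+k. y ^ i / fact i * pochhammer (- real i) k * divided_power (M - i) m R)"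
    using True by (intro sum.mono_neutral_right)
      (auto simp: L_def pochhammer_minus_nat divided_power_def not_le)
  also have "\<dots> = (\<Sum>q=0..L. y ^ (q + k) / fact (q + k) * pochhammer (- real (q + k)) k *
      divided_power (M - (q + k)) m R)"
    by (rule sum.shift_bounds_cl_nat_ivl)
  also have "\<dots> = (\<Sum>q=0..L. (-1) ^ k * y ^ k / fact L * (real (L choose q) * y ^ q * R ^ (L - q)))"
  proof (rule sum.cong[OF refl])
    fix q assume q: "q \<in> {0..L}"
    have "M - (q + k) - m = L - q" "m \<le> M - (q + k)"
      using q True by (auto simp: L_def)
    moreover have "real (L choose q) = fact L / (fact q * fact (L - q))"
      using q by (simp add: binomial_fact)
    ultimately show "y ^ (q + k) / fact (q + k) * pochhammer (- real (q + k)) k *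
      divided_power (M - (q + k)) m R = (-1) ^ k * y ^ k / fact L * (real (L choose q) * y ^ q * R ^ (L - q))"
      unfolding pochhammer_minus_nat divided_power_def by (simp add: power_add)
  qed
  also have "\<dots> = (-1) ^ k * y ^ k / fact L * (y + R) ^ L"
    by (simp add: binomial_ring atMost_atLeast0 sum_distrib_left sum_divide_distrib)
  finally show ?thesis
    using True by (simp add: divided_power_def L_def)
next
  case False
  \<comment> \<open>Each i has i < k or M - i < m, since otherwise m + k \<le> M.\<close>
  then have "y ^ i / fact i * pochhammer (- real i) k * divided_power (M - i) m R = 0"
    if "i \<le> M" for i
    using that by (auto simp: pochhammer_minus_nat divided_power_def)
  then have "(\<Sum>i\<le>M. y ^ i / fact i * pochhammer (- real i) k * divided_power (M - i) m R) = 0"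
    by (intro sum.neutral) auto
  with False show ?thesis
    by (simp add: divided_power_def[of M "m + k"])
qed

text \<open>With L = M - m - k, the factor (-L)_(n-k) is a signed falling factorial that cancels the
  top of L!, and the spare n - k powers of z come out. Afterwards the divided power no longer
  depends on k.\<close>

lemma divided_power_lower:
  assumes "k \<le> n"
  shows "pochhammer (- (real M - real m) + real k) (n - k) * divided_power M (m + k) z =
    (-1) ^ (n - k) * z ^ (n - k) * divided_power M (m + n) z"
proof (cases "m + k \<le> M")
  case True
  have L: "- (real M - real m) + real k = - real (M - m - k)"
    using True by (simp add: of_nat_diff)
  show ?thesis
  proof (cases "m + n \<le> M")
    case le: True
    have "M - (m + k) = (n - k) + (M - (m + n))"
      using le assms by simp
    then have "z ^ (M - (m + k)) = z ^ (n - k) * z ^ (M - (m + n))"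
      by (simp only: power_add)
    moreover have "pochhammer (- (real M - real m) + real k) (n - k) =
        (-1) ^ (n - k) * fact (M - (m + k)) / fact (M - (m + n))"
      using le assms unfolding L pochhammer_minus_nat by (simp add: add.commute)
    ultimately show ?thesis
      using True le unfolding divided_power_def by simp
  next
    case False
    \<comment> \<open>Here n - k exceeds M - m - k, so the Pochhammer symbol vanishes along with the
      right-hand side.\<close>
    then show ?thesis
      using True assms unfolding L pochhammer_minus_nat divided_power_def by auto
  qed
next
  case False
  with assms show ?thesis
    by (simp add: divided_power_def)
qed

text \<open>Summing over i first turns the k-th term of the Hahn polynomial into a divided power
  with index m + k; the cancelled quotient of Pochhammer symbols then lowers it to the common index
  m + n. What remains inside the sum over k is \<open>homog_G\<close>.\<close>

lemma hahn_generating_step: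
  "(\<Sum>i\<le>M. y ^ i / fact i * hahn_Q_scaled n (real i) a b (real M - real m) *
      divided_power (M - i) m R) =
    (-1) ^ n * homog_G n a b y (y + R) * divided_power M (m + n) (y + R)"
proof -
  define w where "w k = pochhammer (- real n) k * pochhammer (real n - a - b - 1) k /
    (pochhammer (- a) k * fact k)" for k
  define p where "p k = pochhammer (- (real M - real m) + real k) (n - k)" for k
  have "(\<Sum>i\<le>M. y ^ i / fact i * hahn_Q_scaled n (real i) a b (real M - real m) *
      divided_power (M - i) m R) =
     (\<Sum>i\<le>M. \<Sum>k=0..n. w k * p k *
        (y ^ i / fact i * pochhammer (- real i) k * divided_power (M - i) m R))"
    unfolding hahn_Q_scaled_def w_def p_def sum_distrib_left sum_distrib_right
    by (intro sum.cong refl) (simp add: mult_ac)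
  also have "\<dots> = (\<Sum>k=0..n. \<Sum>i\<le>M. w k * p k *
        (y ^ i / fact i * pochhammer (- real i) k * divided_power (M - i) m R))"
    by (rule sum.swap)
  also have "\<dots> = (\<Sum>k=0..n. w k * (-1) ^ k * y ^ k * (p k * divided_power M (m + k) (y + R)))"
    unfolding sum_distrib_left[symmetric] divided_power_convolution by (simp add: mult_ac)
  also have "\<dots> = (\<Sum>k=0..n. (-1) ^ n * (w k * (y ^ k * (y + R) ^ (n - k))) *
      divided_power M (m + n) (y + R))"
  proof (rule sum.cong[OF refl])
    fix k assume "k \<in> {0..n}"
    then have k: "k \<le> n" by simp
    have "(-1::real) ^ n = (-1) ^ k * (-1) ^ (n - k)"
      using k by (simp flip: power_add)
    then show "w k * (-1) ^ k * y ^ k * (p k * divided_power M (m + k) (y + R)) =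
      (-1) ^ n * (w k * (y ^ k * (y + R) ^ (n - k))) * divided_power M (m + n) (y + R)"
      unfolding p_def divided_power_lower[OF k] by simp
  qed
  also have "\<dots> = (-1) ^ n * homog_G n a b y (y + R) * divided_power M (m + n) (y + R)"
    unfolding homog_G_def w_def by (simp add: sum_distrib_left sum_distrib_right)
  finally show ?thesis .
qed

section \<open>Multi-indices on a tail of the variables and the generating function in several
  variables\<close>

text \<open>The left end j is a parameter so that variables can be removed one at a time from the
  left.\<close>

definition tail_multi_indices :: "nat \<Rightarrow> nat \<Rightarrow> nat \<Rightarrow> (nat \<Rightarrow> nat) set" where
  "tail_multi_indices j D M = {\<alpha>. (\<forall>i. i \<notin> {j..D} \<longrightarrow> \<alpha> i = 0) \<and> (\<Sum>i=j..D. \<alpha> i) = M}"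

lemma tail_multi_indices_last: "tail_multi_indices D D M = {(\<lambda>_. 0)(D := M)}"
  by (auto simp: tail_multi_indices_def)

text \<open>Overwriting entry j loses nothing, because \<beta> is zero there.\<close>

lemma bij_betw_tail_multi_indices:
  assumes "j \<le> D"
  shows "bij_betw (\<lambda>(i, \<beta>). \<beta>(j := i)) (SIGMA i:{..M}. tail_multi_indices (Suc j) D (M - i))
    (tail_multi_indices j D M)"
proof (rule bij_betw_byWitness[where f' = "\<lambda>\<alpha>. (\<alpha> j, \<alpha>(j := 0))"])
  have split: "(\<Sum>i=j..D. f i) = f j + (\<Sum>i=Suc j..D. f i)" for f :: "nat \<Rightarrow> nat"
    using assms by (rule sum.atLeast_Suc_atMost)
  have upd: "(\<Sum>i=Suc j..D. (f(j := x)) i) = (\<Sum>i=Suc j..D. f i)" for f :: "nat \<Rightarrow> nat" and x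
    by (rule sum.cong) auto
  show "(\<lambda>(i, \<beta>). \<beta>(j := i)) ` (SIGMA i:{..M}. tail_multi_indices (Suc j) D (M - i))
      \<subseteq> tail_multi_indices j D M"
    using assms by (auto simp: tail_multi_indices_def split upd simp del: fun_upd_apply)
      (auto)
  show "(\<lambda>\<alpha>. (\<alpha> j, \<alpha>(j := 0))) ` tail_multi_indices j D M
      \<subseteq> (SIGMA i:{..M}. tail_multi_indices (Suc j) D (M - i))"
    using assms by (auto simp: tail_multi_indices_def split upd simp del: fun_upd_apply)
      (auto)
qed (auto simp: tail_multi_indices_def fun_eq_iff)

lemma finite_tail_multi_indices:
  assumes "j \<le> D"
  shows "finite (tail_multi_indices j D M)"
  using assms
proof (induction arbitrary: M rule: inc_induct)
  case base
  then show ?case by (simp add: tail_multi_indices_last)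
next
  case (step j)
  then have "finite (SIGMA i:{..M}. tail_multi_indices (Suc j) D (M - i))" by auto
  with step show ?case
    using bij_betw_finite[OF bij_betw_tail_multi_indices[of j D M]] by simp
qed

lemma sum_tail_multi_indices:
  assumes "j \<le> D"
  shows "sum f (tail_multi_indices j D M) =
    (\<Sum>i\<le>M. \<Sum>\<beta>\<in>tail_multi_indices (Suc j) D (M - i). f (\<beta>(j := i)) :: real)"
proof (cases "j = D")
  case True
  \<comment> \<open>For j = D no variable is left after removing the first, so only i = M
    contributes.\<close>
  have "tail_multi_indices (Suc D) D m = (if m = 0 then {\<lambda>_. 0} else {})" for m
    by (auto simp: tail_multi_indices_def)
  then have "(\<Sum>i\<le>M. \<Sum>\<beta>\<in>tail_multi_indices (Suc j) D (M - i). f (\<beta>(j := i))) =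
    (\<Sum>i\<le>M. if i = M then f ((\<lambda>_. 0)(D := M)) else 0)"
    using True by (intro sum.cong) (auto simp: fun_upd_def)
  then show ?thesis
    using True by (simp add: tail_multi_indices_last fun_upd_def)
next
  case False
  have "sum f (tail_multi_indices j D M) =
      (\<Sum>p\<in>(SIGMA i:{..M}. tail_multi_indices (Suc j) D (M - i)). f ((\<lambda>(i, \<beta>). \<beta>(j := i)) p))"
    by (rule sum.reindex_bij_betw[OF bij_betw_tail_multi_indices[OF assms], symmetric])
  also have "\<dots> = (\<Sum>i\<le>M. \<Sum>\<beta>\<in>tail_multi_indices (Suc j) D (M - i). f (\<beta>(j := i)))"
    using assms False finite_tail_multi_indices[of "Suc j" D]
    by (subst sum.Sigma) (auto simp: case_prod_beta)
  finally show ?thesis .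
qed

text \<open>Written through the tail sum of \<alpha>, the Hahn factor with index i depends only on
  the entries from i on. For a fixed first entry k the induction hypothesis sums the others with
  total M - k, and \<open>hahn_generating_step\<close> then sums over k with R_j = y_j +
  R_(j+1).\<close>

lemma hahn_generating_function:
  fixes y a b :: "nat \<Rightarrow> real"
  assumes "j \<le> Suc d"
  shows "(\<Sum>\<alpha>\<in>tail_multi_indices j (Suc d) M. (\<Prod>i=j..Suc d. y i ^ \<alpha> i / fact (\<alpha> i)) *
      (\<Prod>i=j..d. hahn_Q_scaled (\<nu> i) (real (\<alpha> i)) (a i) (b i)
         (real (\<Sum>r=i..Suc d. \<alpha> r) - real (tail_sum \<nu> (Suc i) d)))) =
    (\<Prod>i=j..d. (-1) ^ \<nu> i * homog_G (\<nu> i) (a i) (b i) (y i) (\<Sum>r=i..Suc d. y r)) *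
      divided_power M (tail_sum \<nu> j d) (\<Sum>r=j..Suc d. y r)"
  using assms
proof (induction arbitrary: M rule: inc_induct)
  case base
  then show ?case
    by (simp add: tail_multi_indices_last divided_power_def tail_sum_def)
next
  case (step j)
  define q where "q \<alpha> i = hahn_Q_scaled (\<nu> i) (real (\<alpha> i)) (a i) (b i)
         (real (\<Sum>r=i..Suc d. \<alpha> r) - real (tail_sum \<nu> (Suc i) d))" for \<alpha> i
  define G where "G i = (-1) ^ \<nu> i * homog_G (\<nu> i) (a i) (b i) (y i) (\<Sum>r=i..Suc d. y r)" for i
  have j: "j \<le> d" using step by simp
  \<comment> \<open>The tail sum from j is the fixed total M, so the factor with index j does not
    see \<beta>; the later factors do not see k.\<close>
  have term_split: "(\<Prod>i=j..Suc d. y i ^ (\<beta>(j := k)) i / fact ((\<beta>(j := k)) i)) * (\<Prod>i=j..d. q (\<beta>(j := k)) i) =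
      y j ^ k / fact k * hahn_Q_scaled (\<nu> j) (real k) (a j) (b j) (real M - real (tail_sum \<nu> (Suc j) d)) *
      ((\<Prod>i=Suc j..Suc d. y i ^ \<beta> i / fact (\<beta> i)) * (\<Prod>i=Suc j..d. q \<beta> i))"
    if k: "k \<le> M" and \<beta>: "\<beta> \<in> tail_multi_indices (Suc j) (Suc d) (M - k)" for k \<beta>
  proof -
    have "(\<Sum>r=j..Suc d. (\<beta>(j := k)) r) = k + (\<Sum>r=Suc j..Suc d. (\<beta>(j := k)) r)"
      using j by (subst sum.atLeast_Suc_atMost) auto
    also have "(\<Sum>r=Suc j..Suc d. (\<beta>(j := k)) r) = (\<Sum>r=Suc j..Suc d. \<beta> r)"
      by (rule sum.cong) auto
    also have "\<dots> = M - k"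
      using \<beta> by (simp add: tail_multi_indices_def)
    finally have sM: "(\<Sum>r=j..Suc d. (\<beta>(j := k)) r) = M"
      using k by simp
    have "(\<Prod>i=j..d. q (\<beta>(j := k)) i) = q (\<beta>(j := k)) j * (\<Prod>i=Suc j..d. q (\<beta>(j := k)) i)"
      using j by (rule prod.atLeast_Suc_atMost)
    also have "q (\<beta>(j := k)) j = hahn_Q_scaled (\<nu> j) (real k) (a j) (b j)
        (real M - real (tail_sum \<nu> (Suc j) d))"
      unfolding q_def sM by simp
    also have "(\<Prod>i=Suc j..d. q (\<beta>(j := k)) i) = (\<Prod>i=Suc j..d. q \<beta> i)"
    proof (rule prod.cong[OF refl])
      fix i assume i: "i \<in> {Suc j..d}"
      have "(\<Sum>r=i..Suc d. (\<beta>(j := k)) r) = (\<Sum>r=i..Suc d. \<beta> r)"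
        using i by (intro sum.cong) auto
      then show "q (\<beta>(j := k)) i = q \<beta> i"
        using i unfolding q_def by simp
    qed
    finally have Q: "(\<Prod>i=j..d. q (\<beta>(j := k)) i) = hahn_Q_scaled (\<nu> j) (real k) (a j) (b j)
        (real M - real (tail_sum \<nu> (Suc j) d)) * (\<Prod>i=Suc j..d. q \<beta> i)" .
    have "(\<Prod>i=j..Suc d. y i ^ (\<beta>(j := k)) i / fact ((\<beta>(j := k)) i)) =
        y j ^ k / fact k * (\<Prod>i=Suc j..Suc d. y i ^ (\<beta>(j := k)) i / fact ((\<beta>(j := k)) i))"
      using j by (subst prod.atLeast_Suc_atMost) auto
    also have "(\<Prod>i=Suc j..Suc d. y i ^ (\<beta>(j := k)) i / fact ((\<beta>(j := k)) i)) =
        (\<Prod>i=Suc j..Suc d. y i ^ \<beta> i / fact (\<beta> i))"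
      by (rule prod.cong) auto
    finally show ?thesis
      unfolding Q by (simp only: mult_ac)
  qed
  have tail_nu: "tail_sum \<nu> j d = tail_sum \<nu> (Suc j) d + \<nu> j"
    using j by (simp add: tail_sum_def sum.atLeast_Suc_atMost)
  have tail_y: "(\<Sum>r=j..Suc d. y r) = y j + (\<Sum>r=Suc j..Suc d. y r)"
    using j by (intro sum.atLeast_Suc_atMost) simp
  have "(\<Sum>\<alpha>\<in>tail_multi_indices j (Suc d) M. (\<Prod>i=j..Suc d. y i ^ \<alpha> i / fact (\<alpha> i)) * (\<Prod>i=j..d. q \<alpha> i)) =
     (\<Sum>k\<le>M. \<Sum>\<beta>\<in>tail_multi_indices (Suc j) (Suc d) (M - k).
       y j ^ k / fact k * hahn_Q_scaled (\<nu> j) (real k) (a j) (b j) (real M - real (tail_sum \<nu> (Suc j) d)) *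
      ((\<Prod>i=Suc j..Suc d. y i ^ \<beta> i / fact (\<beta> i)) * (\<Prod>i=Suc j..d. q \<beta> i)))"
    using j by (subst sum_tail_multi_indices) (simp, intro sum.cong refl term_split, simp_all)
  also have "\<dots> = (\<Sum>k\<le>M. y j ^ k / fact k *
       hahn_Q_scaled (\<nu> j) (real k) (a j) (b j) (real M - real (tail_sum \<nu> (Suc j) d)) *
      ((\<Prod>i=Suc j..d. G i) * divided_power (M - k) (tail_sum \<nu> (Suc j) d) (\<Sum>r=Suc j..Suc d. y r)))"
    unfolding sum_distrib_left[symmetric] q_def G_def step.IH ..
  also have "\<dots> = (\<Prod>i=Suc j..d. G i) * (\<Sum>k\<le>M. y j ^ k / fact k *
       hahn_Q_scaled (\<nu> j) (real k) (a j) (b j) (real M - real (tail_sum \<nu> (Suc j) d)) *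
       divided_power (M - k) (tail_sum \<nu> (Suc j) d) (\<Sum>r=Suc j..Suc d. y r))"
    by (simp add: sum_distrib_left mult_ac)
  also have "\<dots> = (\<Prod>i=Suc j..d. G i) * (G j * divided_power M (tail_sum \<nu> j d) (\<Sum>r=j..Suc d. y r))"
    unfolding hahn_generating_step tail_nu G_def tail_y[symmetric] by simp
  also have "\<dots> = (\<Prod>i=j..d. G i) * divided_power M (tail_sum \<nu> j d) (\<Sum>r=j..Suc d. y r)"
    using j by (simp add: prod.atLeast_Suc_atMost)
  finally show ?case
    unfolding q_def G_def .
qed

section \<open>Uniqueness of polynomial coefficients\<close>

text \<open>A nonzero polynomial has finitely many roots, whereas already the interval from 0 to 1
  would consist of roots.\<close>

lemma polynomial_zero_if_zero_on_positive:
  fixes b :: "nat \<Rightarrow> real"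
  assumes "\<And>t. t > 0 \<Longrightarrow> (\<Sum>n\<le>K. b n * t ^ n) = 0" and "n \<le> K"
  shows "b n = 0"
proof (rule ccontr)
  assume "b n \<noteq> 0"
  then have "finite {t. (\<Sum>n\<le>K. b n * t ^ n) = 0}"
    using assms(2) by (rule polyfun_finite_roots[THEN iffD2, OF exI, OF conjI, rotated])
  then have "finite {0<..1::real}"
    by (rule rev_finite_subset) (use assms(1) in auto)
  then show False
    by (simp add: infinite_Ioc)
qed

text \<open>Stated for multi-indices that are determined by their first \<open>m\<close> entries, so that the
  induction on \<open>m\<close> can fix the value of the last entry without changing the multi-index.\<close>

lemma monomials_independent_on_positive:
  fixes c :: "(nat \<Rightarrow> nat) \<Rightarrow> real"
  assumes "finite F"
    and "\<And>\<alpha> \<beta>. \<alpha> \<in> F \<Longrightarrow> \<beta> \<in> F \<Longrightarrow> (\<forall>i\<in>{1..m}. \<alpha> i = \<beta> i) \<Longrightarrow> \<alpha> = \<beta>"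
    and "\<And>y. (\<And>i. y i > 0) \<Longrightarrow> (\<Sum>\<alpha>\<in>F. c \<alpha> * monomial_at m y \<alpha>) = 0"
    and "\<alpha> \<in> F"
  shows "c \<alpha> = 0"
  using assms
proof (induction m arbitrary: F)
  case 0
  \<comment> \<open>With no variables, any two members of F agree vacuously on their
    entries.\<close>
  then have "F = {\<alpha>}" by auto
  with 0(3)[of "\<lambda>_. 1"] show ?case
    by (simp add: monomial_at_def)
next
  case (Suc m)
  define K where "K = Max ((\<lambda>\<beta>. \<beta> (Suc m)) ` F)"
  have K: "\<beta> (Suc m) \<le> K" if "\<beta> \<in> F" for \<beta>
    unfolding K_def using that Suc.prems(1) by auto
  \<comment> \<open>F is sorted by the exponent of the last variable. With the other variables
    fixed, the sum over F is a polynomial in the last one whose coefficients are the sums over the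
    sets \<open>F' n\<close>; these vanish and fall under the induction hypothesis.\<close>
  define F' where "F' n = {\<beta> \<in> F. \<beta> (Suc m) = n}" for n
  have "(\<Sum>\<beta>\<in>F' n. c \<beta> * monomial_at m y \<beta>) = 0" if y: "\<And>i. y i > 0" and n: "n \<le> K" for y n
  proof (rule polynomial_zero_if_zero_on_positive[where K = K, OF _ n])
    fix t :: real assume t: "t > 0"
    have "(\<Sum>n\<le>K. (\<Sum>\<beta>\<in>F' n. c \<beta> * monomial_at m y \<beta>) * t ^ n) =
        (\<Sum>n\<le>K. \<Sum>\<beta>\<in>F' n. c \<beta> * monomial_at m y \<beta> * t ^ \<beta> (Suc m))"
      by (intro sum.cong) (auto simp: sum_distrib_right F'_def)
    also have "\<dots> = (\<Sum>\<beta>\<in>F. c \<beta> * monomial_at m y \<beta> * t ^ \<beta> (Suc m))"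
      unfolding F'_def using Suc.prems(1) K by (intro sum.group) auto
    also have "\<dots> = (\<Sum>\<beta>\<in>F. c \<beta> * monomial_at (Suc m) (y(Suc m := t)) \<beta>)"
      by (intro sum.cong refl) (auto simp: monomial_at_def)
    also have "\<dots> = 0"
      using y t by (intro Suc.prems) auto
    finally show "(\<Sum>n\<le>K. (\<Sum>\<beta>\<in>F' n. c \<beta> * monomial_at m y \<beta>) * t ^ n) = 0" .
  qed
  moreover have "\<beta> = \<gamma>" if "\<beta> \<in> F' n" "\<gamma> \<in> F' n" "\<forall>i\<in>{1..m}. \<beta> i = \<gamma> i" for \<beta> \<gamma> n
  proof (rule Suc.prems(2))
    show "\<forall>i\<in>{1..Suc m}. \<beta> i = \<gamma> i"
      using that by (auto simp: F'_def le_Suc_eq)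
  qed (use that in \<open>auto simp: F'_def\<close>)
  ultimately show ?case
    using Suc.prems(1,4) K by (intro Suc.IH[of "F' (\<alpha> (Suc m))"]) (auto simp: F'_def)
qed

section \<open>Both sides of the identity as the same product\<close>

lemma multi_indices_of_sum_eq: "multi_indices_of_sum m N = tail_multi_indices 1 m N"
  by (auto simp: multi_indices_of_sum_def multi_indices_def tail_multi_indices_def head_sum_def)

lemma head_sum_add_tail:
  assumes "1 \<le> j" "j \<le> Suc m"
  shows "head_sum f m = head_sum f (j - 1) + (\<Sum>i=j..m. f i)"
proof -
  have "{1..m} = {1..j - 1} \<union> {j..m}" "{1..j - 1} \<inter> {j..m} = {}"
    using assms by auto
  then show ?thesis
    unfolding head_sum_def by (simp add: sum.union_disjoint)
qed

text \<open>A proper initial sum of positive coordinates is strictly smaller than the full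
  sum.\<close>

lemma admissible_of_positive:
  assumes "\<And>i. y i > 0"
  shows "admissible d y"
proof -
  have pos: "(\<Sum>i=j..d + 1. y i) > 0" if "j \<le> d + 1" for j
    using assms that by (intro sum_pos) auto
  have s: "head_sum y (d + 1) > 0"
    using pos[of 1] by (simp add: head_sum_def)
  moreover have "1 - head_sum (\<lambda>i. y i / head_sum y (d + 1)) (j - 1) \<noteq> 0" if "j \<in> {1..d}" for j
  proof -
    have "head_sum (\<lambda>i. y i / head_sum y (d + 1)) (j - 1) = head_sum y (j - 1) / head_sum y (d + 1)"
      by (simp add: head_sum_def sum_divide_distrib)
    moreover have "head_sum y (j - 1) < head_sum y (d + 1)"
      using head_sum_add_tail[of j "d + 1" y] that pos[of j] by simp
    ultimately show ?thesis
      using s by simp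
  qed
  ultimately show ?thesis
    unfolding admissible_def by auto
qed

text \<open>Since 1 - |x_(j-1)| = R_j / s, giving s^(\<nu>_j) to the factor with index j clears its
  denominator and makes \<open>G_uni_homog\<close> applicable; the power s^(N - |\<nu>|) is left
  over.\<close>

lemma homogenized_G_poly:
  assumes \<nu>: "\<nu> \<in> H_set d l N" and y: "admissible d y"
  defines "s \<equiv> head_sum y (d + 1)"
  shows "s ^ N * G_poly d l \<nu> (\<lambda>i. y i / s) = s ^ (N - head_sum \<nu> d) *
    (\<Prod>j=1..d. (-1) ^ \<nu> j * (pochhammer (- real (l j)) (\<nu> j) / pochhammer (- of_int (a_par d l \<nu> j)) (\<nu> j)) *
       homog_G (\<nu> j) (real (l j)) (of_int (a_par d l \<nu> j)) (y j) (\<Sum>r=j..Suc d. y r))"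
proof -
  have s: "s \<noteq> 0" using y by (simp add: admissible_def s_def)
  have factor: "s ^ \<nu> j * ((1 - head_sum (\<lambda>i. y i / s) (j - 1)) ^ \<nu> j *
      G_uni (\<nu> j) (a_par d l \<nu> j) (int (l j)) (2 * (y j / s) / (1 - head_sum (\<lambda>i. y i / s) (j - 1)) - 1)) =
      (-1) ^ \<nu> j * (pochhammer (- real (l j)) (\<nu> j) / pochhammer (- of_int (a_par d l \<nu> j)) (\<nu> j)) *
       homog_G (\<nu> j) (real (l j)) (of_int (a_par d l \<nu> j)) (y j) (\<Sum>r=j..Suc d. y r)"
    if j: "j \<in> {1..d}" for j
  proof -
    define R where "R = (\<Sum>r=j..Suc d. y r)"
    have "head_sum (\<lambda>i. y i / s) (j - 1) = head_sum y (j - 1) / s"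
      by (simp add: head_sum_def sum_divide_distrib)
    moreover have "s = head_sum y (j - 1) + R"
      using head_sum_add_tail[of j "d + 1" y] j by (simp add: s_def R_def)
    ultimately have X: "1 - head_sum (\<lambda>i. y i / s) (j - 1) = R / s"
      using s by (simp add: field_simps)
    then have R: "R \<noteq> 0"
      using y j s by (auto simp: admissible_def s_def)
    have "s ^ \<nu> j * (R / s) ^ \<nu> j = R ^ \<nu> j"
      using s by (simp add: power_divide)
    moreover have "2 * (y j / s) / (R / s) = 2 * y j / R"
      using s by simp
    moreover have "int (\<nu> j) \<le> a_par d l \<nu> j" "int (\<nu> j) \<le> int (l j)"
      using \<nu> j by (auto simp: H_set_def)
    ultimately show ?thesis
      unfolding X R_def[symmetric] mult.assoc[symmetric]
      using G_uni_homog[of "\<nu> j" "a_par d l \<nu> j" "int (l j)" R "y j"] R by simp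
  qed
  \<comment> \<open>This keeps the subtraction in the exponent N - |\<nu>| from being
    truncated.\<close>
  have "head_sum \<nu> d \<le> N" using \<nu> by (simp add: H_set_def)
  then have "s ^ N = s ^ (N - head_sum \<nu> d) * (\<Prod>j=1..d. s ^ \<nu> j)"
    by (simp add: head_sum_def flip: power_sum power_add)
  then have "s ^ N * G_poly d l \<nu> (\<lambda>i. y i / s) = s ^ (N - head_sum \<nu> d) *
     (\<Prod>j=1..d. s ^ \<nu> j * ((1 - head_sum (\<lambda>i. y i / s) (j - 1)) ^ \<nu> j *
      G_uni (\<nu> j) (a_par d l \<nu> j) (int (l j)) (2 * (y j / s) / (1 - head_sum (\<lambda>i. y i / s) (j - 1)) - 1)))"
    unfolding G_poly_def by (simp add: prod.distrib)
  also have "\<dots> = s ^ (N - head_sum \<nu> d) * (\<Prod>j=1..d.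
      (-1) ^ \<nu> j * (pochhammer (- real (l j)) (\<nu> j) / pochhammer (- of_int (a_par d l \<nu> j)) (\<nu> j)) *
       homog_G (\<nu> j) (real (l j)) (of_int (a_par d l \<nu> j)) (y j) (\<Sum>r=j..Suc d. y r))"
    by (simp only: factor cong: prod.cong)
  finally show ?thesis .
qed

text \<open>This is \<open>hahn_generating_function\<close> at j = 1 and M = N with the
  normalisation of \<open>hahn_H\<close> put back. No coordinate is divided by, so it holds at every
  y.\<close>

lemma hahn_H_generating_function:
  fixes l :: "nat \<Rightarrow> nat"
  assumes \<nu>: "head_sum \<nu> d \<le> N"
  defines "w \<equiv> \<lambda>j. pochhammer (- real (l j)) (\<nu> j) / pochhammer (- of_int (a_par d l \<nu> j)) (\<nu> j)"
  shows "(\<Sum>\<alpha>\<in>multi_indices_of_sum (d + 1) N.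
       fact N / multi_fact (d + 1) \<alpha> * hahn_H d \<nu> l N \<alpha> * monomial_at (d + 1) y \<alpha>) =
    head_sum y (d + 1) ^ (N - head_sum \<nu> d) * (\<Prod>j=1..d. (-1) ^ \<nu> j * w j *
       homog_G (\<nu> j) (real (l j)) (of_int (a_par d l \<nu> j)) (y j) (\<Sum>r=j..Suc d. y r))"
proof -
  let ?n = "head_sum \<nu> d"
  \<comment> \<open>The normalisation turns N! into (N - |\<nu>|)!, which cancels the denominator of
    the divided power arising from the sum.\<close>
  have const: "fact N * ((-1) ^ ?n / pochhammer (- real N) ?n) = (fact (N - ?n) :: real)"
    using \<nu> by (simp add: pochhammer_minus_nat)
  have summand: "fact N / multi_fact (d + 1) \<alpha> * hahn_H d \<nu> l N \<alpha> * monomial_at (d + 1) y \<alpha> =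
      fact (N - ?n) * (\<Prod>j=1..d. w j) * ((\<Prod>i=1..Suc d. y i ^ \<alpha> i / fact (\<alpha> i)) *
      (\<Prod>i=1..d. hahn_Q_scaled (\<nu> i) (real (\<alpha> i)) (real (l i)) (of_int (a_par d l \<nu> i))
         (real (\<Sum>r=i..Suc d. \<alpha> r) - real (tail_sum \<nu> (Suc i) d))))"
    if \<alpha>: "\<alpha> \<in> tail_multi_indices 1 (d + 1) N" for \<alpha>
  proof -
    \<comment> \<open>For |\<alpha>| = N, subtracting the entries before j from N leaves the tail
      sum from j.\<close>
    have Q: "hahn_Q_multi d \<nu> l N (\<lambda>i. real (\<alpha> i)) =
        (\<Prod>i=1..d. hahn_Q_scaled (\<nu> i) (real (\<alpha> i)) (real (l i)) (of_int (a_par d l \<nu> i))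
         (real (\<Sum>r=i..Suc d. \<alpha> r) - real (tail_sum \<nu> (Suc i) d)))"
      unfolding hahn_Q_multi_def
    proof (rule prod.cong[OF refl])
      fix j assume j: "j \<in> {1..d}"
      have "head_sum \<alpha> (d + 1) = N"
        using \<alpha> by (simp add: tail_multi_indices_def head_sum_def)
      then have "N = head_sum \<alpha> (j - 1) + (\<Sum>i=j..Suc d. \<alpha> i)"
        using head_sum_add_tail[of j "d + 1" \<alpha>] j by simp
      then have "real N - head_sum (\<lambda>i. real (\<alpha> i)) (j - 1) = real (\<Sum>i=j..Suc d. \<alpha> i)"
        by (simp add: head_sum_def)
      then show "hahn_Q_scaled (\<nu> j) (real (\<alpha> j)) (real (l j)) (of_int (a_par d l \<nu> j))
          (real N - head_sum (\<lambda>i. real (\<alpha> i)) (j - 1) - real (tail_sum \<nu> (j + 1) d)) =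
        hahn_Q_scaled (\<nu> j) (real (\<alpha> j)) (real (l j)) (of_int (a_par d l \<nu> j))
         (real (\<Sum>r=j..Suc d. \<alpha> r) - real (tail_sum \<nu> (Suc j) d))"
        by simp
    qed
    have mon: "monomial_at (d + 1) y \<alpha> / multi_fact (d + 1) \<alpha> =
        (\<Prod>i=1..Suc d. y i ^ \<alpha> i / fact (\<alpha> i))"
      by (simp add: monomial_at_def multi_fact_def prod_dividef)
    have "fact N / multi_fact (d + 1) \<alpha> * hahn_H d \<nu> l N \<alpha> * monomial_at (d + 1) y \<alpha> =
        fact N * ((-1) ^ ?n / pochhammer (- real N) ?n) * (\<Prod>j=1..d. w j) *
        (monomial_at (d + 1) y \<alpha> / multi_fact (d + 1) \<alpha> * hahn_Q_multi d \<nu> l N (\<lambda>i. real (\<alpha> i)))"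
      unfolding hahn_H_def w_def by (simp add: mult_ac)
    then show ?thesis
      unfolding const Q mon .
  qed
  have one: "1 \<le> Suc d" by simp
  have "(\<Sum>\<alpha>\<in>multi_indices_of_sum (d + 1) N.
       fact N / multi_fact (d + 1) \<alpha> * hahn_H d \<nu> l N \<alpha> * monomial_at (d + 1) y \<alpha>) =
    (\<Sum>\<alpha>\<in>tail_multi_indices 1 (Suc d) N. fact (N - ?n) * (\<Prod>j=1..d. w j) *
      ((\<Prod>i=1..Suc d. y i ^ \<alpha> i / fact (\<alpha> i)) *
      (\<Prod>i=1..d. hahn_Q_scaled (\<nu> i) (real (\<alpha> i)) (real (l i)) (of_int (a_par d l \<nu> i))
         (real (\<Sum>r=i..Suc d. \<alpha> r) - real (tail_sum \<nu> (Suc i) d)))))"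
    unfolding multi_indices_of_sum_eq Suc_eq_plus1[of d, symmetric]
    by (intro sum.cong refl summand[unfolded Suc_eq_plus1[of d, symmetric]])
  also have "\<dots> = fact (N - ?n) * (\<Prod>j=1..d. w j) * ((\<Prod>i=1..d. (-1) ^ \<nu> i *
        homog_G (\<nu> i) (real (l i)) (of_int (a_par d l \<nu> i)) (y i) (\<Sum>r=i..Suc d. y r)) *
      divided_power N (tail_sum \<nu> 1 d) (\<Sum>r=1..Suc d. y r))"
    unfolding sum_distrib_left[symmetric] hahn_generating_function[OF one] ..
  also have "\<dots> = (fact (N - ?n) * divided_power N (tail_sum \<nu> 1 d) (\<Sum>r=1..Suc d. y r)) *
      ((\<Prod>j=1..d. w j) * (\<Prod>i=1..d. (-1) ^ \<nu> i *
        homog_G (\<nu> i) (real (l i)) (of_int (a_par d l \<nu> i)) (y i) (\<Sum>r=i..Suc d. y r)))"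
    by (simp only: mult_ac)
  also have "fact (N - ?n) * divided_power N (tail_sum \<nu> 1 d) (\<Sum>r=1..Suc d. y r) =
      head_sum y (d + 1) ^ (N - ?n)"
    using \<nu> by (simp add: divided_power_def head_sum_def tail_sum_def)
  also have "(\<Prod>j=1..d. w j) * (\<Prod>i=1..d. (-1) ^ \<nu> i *
        homog_G (\<nu> i) (real (l i)) (of_int (a_par d l \<nu> i)) (y i) (\<Sum>r=i..Suc d. y r)) =
      (\<Prod>j=1..d. (-1) ^ \<nu> j * w j *
       homog_G (\<nu> j) (real (l j)) (of_int (a_par d l \<nu> j)) (y j) (\<Sum>r=j..Suc d. y r))"
    unfolding prod.distrib[symmetric] by (intro prod.cong refl) (simp only: mult_ac)
  finally show ?thesis .
qed

text \<open>The quotients on the left are meaningful only at admissible points. The second conjunct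
  makes the right-hand side the only polynomial of its shape that agrees with the left there, hence
  the homogeneous polynomial that the left defines.\<close>

theorem proposition5p1:
  fixes d N :: nat and l \<nu> :: "nat \<Rightarrow> nat"
  assumes "1 \<le> d" and "1 \<le> N"
    and "\<forall>i\<in>{1..d + 1}. 1 \<le> l i \<and> l i \<le> N"
    and "\<forall>i\<in>{1..d + 1}. \<forall>j\<in>{1..d + 1}. i \<noteq> j \<longrightarrow> N \<le> l i + l j"
    and "\<nu> \<in> H_set d l N"
  shows "(\<forall>y. admissible d y \<longrightarrow>
            head_sum y (d + 1) ^ N * G_poly d l \<nu> (\<lambda>i. y i / head_sum y (d + 1)) =
            (\<Sum>\<alpha>\<in>multi_indices_of_sum (d + 1) N.
               fact N / multi_fact (d + 1) \<alpha> * hahn_H d \<nu> l N \<alpha> * monomial_at (d + 1) y \<alpha>)) \<and>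
         (\<forall>c. (\<forall>y. admissible d y \<longrightarrow>
                 head_sum y (d + 1) ^ N * G_poly d l \<nu> (\<lambda>i. y i / head_sum y (d + 1)) =
                 (\<Sum>\<alpha>\<in>multi_indices_of_sum (d + 1) N. c \<alpha> * monomial_at (d + 1) y \<alpha>)) \<longrightarrow>
              (\<forall>\<alpha>\<in>multi_indices_of_sum (d + 1) N.
                 c \<alpha> = fact N / multi_fact (d + 1) \<alpha> * hahn_H d \<nu> l N \<alpha>))"
proof (intro conjI allI impI ballI)
  have \<nu>: "head_sum \<nu> d \<le> N"
    using assms(5) by (simp add: H_set_def)
  show eq: "head_sum y (d + 1) ^ N * G_poly d l \<nu> (\<lambda>i. y i / head_sum y (d + 1)) =
      (\<Sum>\<alpha>\<in>multi_indices_of_sum (d + 1) N.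
         fact N / multi_fact (d + 1) \<alpha> * hahn_H d \<nu> l N \<alpha> * monomial_at (d + 1) y \<alpha>)"
    if "admissible d y" for y
    using homogenized_G_poly[OF assms(5) that] hahn_H_generating_function[OF \<nu>, of l y] by simp
  fix c \<alpha>
  assume c: "\<forall>y. admissible d y \<longrightarrow>
      head_sum y (d + 1) ^ N * G_poly d l \<nu> (\<lambda>i. y i / head_sum y (d + 1)) =
      (\<Sum>\<alpha>\<in>multi_indices_of_sum (d + 1) N. c \<alpha> * monomial_at (d + 1) y \<alpha>)"
    and \<alpha>: "\<alpha> \<in> multi_indices_of_sum (d + 1) N"
  \<comment> \<open>The differences of the two coefficient families give a polynomial that vanishes
    at all positive points.\<close>
  have "c \<alpha> - fact N / multi_fact (d + 1) \<alpha> * hahn_H d \<nu> l N \<alpha> = 0"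
  proof (rule monomials_independent_on_positive[OF _ _ _ \<alpha>])
    show "finite (multi_indices_of_sum (d + 1) N)"
      unfolding multi_indices_of_sum_eq by (rule finite_tail_multi_indices) simp
    show "\<beta> = \<gamma>" if "\<beta> \<in> multi_indices_of_sum (d + 1) N" "\<gamma> \<in> multi_indices_of_sum (d + 1) N"
      "\<forall>i\<in>{1..d + 1}. \<beta> i = \<gamma> i" for \<beta> \<gamma>
    proof
      show "\<beta> i = \<gamma> i" for i
        using that by (cases "i \<in> {1..d + 1}") (auto simp: multi_indices_of_sum_def multi_indices_def)
    qed
    fix y :: "nat \<Rightarrow> real" assume "\<And>i. y i > 0"
    then have "admissible d y" by (rule admissible_of_positive)
    then show "(\<Sum>\<alpha>\<in>multi_indices_of_sum (d + 1) N.
        (c \<alpha> - fact N / multi_fact (d + 1) \<alpha> * hahn_H d \<nu> l N \<alpha>) * monomial_at (d + 1) y \<alpha>) = 0"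
      using c eq by (simp add: left_diff_distrib sum_subtractf)
  qed
  then show "c \<alpha> = fact N / multi_fact (d + 1) \<alpha> * hahn_H d \<nu> l N \<alpha>"
    by simp
qed

end
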